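(* Let $F$ be a symmetric IEM on $[0,1)$ with reflection $R(x)=-x\bmod 1$, or a symmetric CEM on $\mathbb{R}/\mathbb{Z}$ with initial and final rotations $\theta_0,\theta_1$ and reflection $R(x)=-x+\theta_0+\theta_1\bmod 1$. Then every periodic interval $J$ of $F$ is symmetric: there exists $k\ge 0$ such that $R(J)=F^k(J)$ (equality of interiors).
   Context: A symmetric IEM is an interval exchange map on $[0,1)$ (a bijection that translates each of consecutive left-closed right-open elemental subintervals $J_1,\dots,J_d$) whose images appear in reversed order $F(J_d),\dots,F(J_1)$. A CEM on $\mathbb{R}/\mathbb{Z}$ with lengths $\lambda_1,\dots,\lambda_d>0$ ($\sum\lambda_i=1$), initial rotation $\theta_0$ and final rotation $\theta_1$ partitions the circle into consecutive arcs $J_1,\dots,J_d$ of lengths $\lambda_i$ starting at $\theta_0$, and maps $J_i$ by $x\mapsto x+\omega_i-\theta_0+\theta_1\bmod 1$, where $\omega$ is the translation vector of the IEM on $[0,1)$ with the same lengths and combinatorics; it is symmetric if it reverses the order of the arcs, i.e. $\omega_i=\sum_{j>i}\lambda_j-\sum_{j<i}\lambda_j$. A $q$-periodic interval (arc) $J$ is one for which $q$ is the least positive integer with $F^q(J)=J$, each $F^k(J)$ lies in a single elemental subinterval, and $J$ is maximal with these properties. *)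

theory Defs
  imports "HOL-Analysis.Analysis"
begin

text \<open>Lengths are given as lam :: nat => real, with pieces indexed 0..d-1
  (piece i here is the paper's J_(i+1)).\<close>

definition psum :: "(nat \<Rightarrow> real) \<Rightarrow> nat \<Rightarrow> real" where
  "psum lam i = (\<Sum>j<i. lam j)"

definition elem_int :: "(nat \<Rightarrow> real) \<Rightarrow> nat \<Rightarrow> real set" where
  "elem_int lam i = {psum lam i ..< psum lam (Suc i)}"

text \<open>Translation vector of the symmetric (order-reversing) IEM.\<close>
definition sym_omega :: "(nat \<Rightarrow> real) \<Rightarrow> nat \<Rightarrow> nat \<Rightarrow> real" where
  "sym_omega lam d i = (\<Sum>j\<in>{Suc i..<d}. lam j) - (\<Sum>j<i. lam j)"

definition piece_index :: "(nat \<Rightarrow> real) \<Rightarrow> nat \<Rightarrow> real \<Rightarrow> nat" where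
  "piece_index lam d y = (THE i. i < d \<and> y \<in> elem_int lam i)"

text \<open>Symmetric IEM on [0,1) (values outside [0,1) are irrelevant).\<close>
definition sym_iem :: "(nat \<Rightarrow> real) \<Rightarrow> nat \<Rightarrow> real \<Rightarrow> real" where
  "sym_iem lam d x = x + sym_omega lam d (piece_index lam d x)"

definition iem_refl :: "real \<Rightarrow> real" where
  "iem_refl x = frac (- x)"

text \<open>Circle R/Z is represented through lifts: subsets of the circle are
  represented by their (Z-periodic) preimages in R, and the CEM by its
  natural lift, which commutes with x |-> x + 1.\<close>

definition sym_cem :: "(nat \<Rightarrow> real) \<Rightarrow> nat \<Rightarrow> real \<Rightarrow> real \<Rightarrow> real \<Rightarrow> real" where
  "sym_cem lam d \<theta>0 \<theta>1 x =
     x + sym_omega lam d (piece_index lam d (frac (x - \<theta>0))) - \<theta>0 + \<theta>1"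

definition cem_refl :: "real \<Rightarrow> real \<Rightarrow> real \<Rightarrow> real" where
  "cem_refl \<theta>0 \<theta>1 x = - x + \<theta>0 + \<theta>1"

definition elem_arc :: "(nat \<Rightarrow> real) \<Rightarrow> real \<Rightarrow> nat \<Rightarrow> real set" where
  "elem_arc lam \<theta>0 i = {x. frac (x - \<theta>0) \<in> elem_int lam i}"

definition circle_arc :: "real set \<Rightarrow> bool" where
  "circle_arc A \<longleftrightarrow> (\<exists>I::real set. is_interval I \<and> A = {x. \<exists>n::int. x - of_int n \<in> I})"

definition iem_periodic_interval :: "(nat \<Rightarrow> real) \<Rightarrow> nat \<Rightarrow> real set \<Rightarrow> nat \<Rightarrow> bool" where
  "iem_periodic_interval lam d J q \<longleftrightarrow>
     is_interval J \<and> 0 < q \<and>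
     (sym_iem lam d ^^ q) ` J = J \<and>
     (\<forall>p. 0 < p \<and> p < q \<longrightarrow> (sym_iem lam d ^^ p) ` J \<noteq> J) \<and>
     (\<forall>k. \<exists>i<d. (sym_iem lam d ^^ k) ` J \<subseteq> elem_int lam i) \<and>
     (\<forall>J'. is_interval J' \<and> J \<subseteq> J' \<and> (sym_iem lam d ^^ q) ` J' = J' \<and>
           (\<forall>k. \<exists>i<d. (sym_iem lam d ^^ k) ` J' \<subseteq> elem_int lam i) \<longrightarrow> J' = J)"

definition cem_periodic_arc ::
  "(nat \<Rightarrow> real) \<Rightarrow> nat \<Rightarrow> real \<Rightarrow> real \<Rightarrow> real set \<Rightarrow> nat \<Rightarrow> bool" where
  "cem_periodic_arc lam d \<theta>0 \<theta>1 A q \<longleftrightarrow>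
     circle_arc A \<and> 0 < q \<and>
     (sym_cem lam d \<theta>0 \<theta>1 ^^ q) ` A = A \<and>
     (\<forall>p. 0 < p \<and> p < q \<longrightarrow> (sym_cem lam d \<theta>0 \<theta>1 ^^ p) ` A \<noteq> A) \<and>
     (\<forall>k. \<exists>i<d. (sym_cem lam d \<theta>0 \<theta>1 ^^ k) ` A \<subseteq> elem_arc lam \<theta>0 i) \<and>
     (\<forall>A'. circle_arc A' \<and> A \<subseteq> A' \<and> (sym_cem lam d \<theta>0 \<theta>1 ^^ q) ` A' = A' \<and>
           (\<forall>k. \<exists>i<d. (sym_cem lam d \<theta>0 \<theta>1 ^^ k) ` A' \<subseteq> elem_arc lam \<theta>0 i)
           \<longrightarrow> A' = A)"

end

(* Up to interval endpoints F = R S, where S reverses every elemental interval, so R F R is the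
   inverse of F and R maps periodic intervals to periodic intervals; it remains to see that R J lies
   on the orbit of J. Let x be an interior point of J and let P be the union of the orbits of x and
   R x, a finite set invariant under R and S. If R or S fixes a point of P, the two orbits agree.
   Otherwise every elemental interval contains an even number of points of P, so the parity of the
   number of points of P to the left of a point is even at every division point, and the two
   arcs that R reverses are even for the same reason. Hence R and S permute the gaps of P of odd
   parity, and such a gap never contains a division point: its two ends have the same itinerary.
   Parity prevents the ends from being on one orbit, so some point of the orbit of x has the same
   itinerary as a point of the orbit of R x, and by maximality a periodic interval is the set of
   all points with a given itinerary.
   (Geometrically: on the sphere obtained by folding along R and S the leaf through x is a simple
   closed curve, and the side of it that misses the division points is foliated by parallel leaves.) *)

theory Submission
  imports Defs
begin

section \<open>Parity of ranks in a finite set of reals\<close>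

definition below_count :: "real set \<Rightarrow> real \<Rightarrow> nat" where
  "below_count P y = card {p\<in>P. p < y}"

text \<open>Neighbours \<open>u < v\<close> in \<open>P\<close> such that an odd number of points of \<open>P\<close> lie to the left of the
  gap between them. Counting from the left, this cuts \<open>P\<close> into consecutive couples.\<close>

definition odd_gap :: "real set \<Rightarrow> real \<Rightarrow> real \<Rightarrow> bool" where
  "odd_gap P u v \<longleftrightarrow> u \<in> P \<and> v \<in> P \<and> even (below_count P u) \<and> below_count P v = Suc (below_count P u)"

lemma even_card_involution:
  assumes "finite A" "\<And>x. x \<in> A \<Longrightarrow> f x \<in> A" "\<And>x. x \<in> A \<Longrightarrow> f (f x) = x" "\<And>x. x \<in> A \<Longrightarrow> f x \<noteq> x"
  shows "even (card A)"
  using assms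
proof (induction "card A" arbitrary: A rule: less_induct)
  case less
  show ?case
  proof (cases "A = {}")
    case False
    then obtain x where x: "x \<in> A" by auto
    let ?B = "A - {x, f x}"
    have fx: "f x \<in> A" "f x \<noteq> x" using less.prems x by auto
    have "card {x, f x} \<le> card A"
      using less.prems(1) x fx by (intro card_mono) auto
    then have cA: "card A = card ?B + 2"
      using less.prems(1) x fx by (simp add: card_Diff_subset)
    have "even (card ?B)"
    proof (rule less.hyps)
      show "card ?B < card A" using cA by simp
      show "finite ?B" using less.prems(1) by simp
      show "f y \<in> ?B" if "y \<in> ?B" for y
        using that less.prems(2)[of y] less.prems(3)[of y] less.prems(3)[of x] x by auto
      show "f (f y) = y" if "y \<in> ?B" for y using that less.prems(3) by auto
      show "f y \<noteq> y" if "y \<in> ?B" for y using that less.prems(4) by auto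
    qed
    then show ?thesis using cA by simp
  qed simp
qed

lemma below_count_add:
  assumes "finite P" "lo \<le> y"
  shows "below_count P y = below_count P lo + card {p\<in>P. lo \<le> p \<and> p < y}"
proof -
  have "{p\<in>P. p < y} = {p\<in>P. p < lo} \<union> {p\<in>P. lo \<le> p \<and> p < y}"
    using assms by auto
  then show ?thesis unfolding below_count_def
    using assms by (simp add: card_Un_disjoint disjoint_iff)
qed

lemma below_count_less_iff:
  assumes "finite P" "u \<in> P"
  shows "below_count P u < below_count P v \<longleftrightarrow> u < v"
proof
  assume "u < v"
  then have "{p\<in>P. p < u} \<subset> {p\<in>P. p < v}" using assms by auto
  then show "below_count P u < below_count P v" unfolding below_count_def
    using assms by (intro psubset_card_mono) auto
next
  assume *: "below_count P u < below_count P v"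
  show "u < v"
  proof (rule ccontr)
    assume "\<not> u < v"
    then have "below_count P v \<le> below_count P u" unfolding below_count_def
      using assms by (intro card_mono) auto
    then show False using * by simp
  qed
qed

text \<open>The mirror image \<open>lo + hi - y\<close> acts on the points of \<open>P\<close> in
  the block without fixed points, so their number is even. The ranks of a point and of its mirror
  image add up to an odd constant, so the mirror swaps the two parities as well as left and right,
  and couples go to couples. The left end \<open>lo\<close> has to be excluded because its mirror
  image \<open>hi\<close> lies outside the block.\<close>

lemma block_reflect:
  assumes fin: "finite P" and le: "lo \<le> hi" and ev: "even (below_count P lo)"
    and refl: "\<And>y. y \<in> P \<Longrightarrow> lo \<le> y \<Longrightarrow> y < hi \<Longrightarrow> lo + hi - y \<in> P \<and> y \<noteq> lo \<and> 2 * y \<noteq> lo + hi"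
  shows "even (below_count P hi)"
    and "\<And>u v. odd_gap P u v \<Longrightarrow> lo \<le> u \<Longrightarrow> u < hi \<Longrightarrow> v < hi \<and> odd_gap P (lo + hi - v) (lo + hi - u)"
proof -
  define B where "B = {p\<in>P. lo \<le> p \<and> p < hi}"
  have finB: "finite B" using fin by (simp add: B_def)
  have BB: "lo + hi - y \<in> B" if "y \<in> B" for y
    using refl[of y] that unfolding B_def by auto
  have evB: "even (card B)"
  proof (rule even_card_involution[where f = "\<lambda>y. lo + hi - y"])
    show "lo + hi - y \<noteq> y" if "y \<in> B" for y
      using refl[of y] that unfolding B_def by auto
  qed (use finB BB in auto)
  show evhi: "even (below_count P hi)"
    using below_count_add[OF fin le] ev evB by (simp add: B_def)
  \<comment> \<open>Points of the block to the left of the mirror image of \<open>y\<close>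
    correspond to points of the block to the right of \<open>y\<close>. The \<open>+ 1\<close>
    accounts for \<open>y\<close> itself.\<close>
  have formula: "below_count P (lo + hi - y) + below_count P y + 1 = 2 * below_count P lo + card B" if y: "y \<in> B" for y
  proof -
    let ?s = "lo + hi - y"
    have s: "?s \<in> B" using BB y .
    have 1: "below_count P ?s = below_count P lo + card {p\<in>P. lo \<le> p \<and> p < ?s}"
      using s by (intro below_count_add fin) (simp add: B_def)
    have 2: "below_count P y = below_count P lo + card {p\<in>P. lo \<le> p \<and> p < y}"
      using y by (intro below_count_add fin) (simp add: B_def)
    have "bij_betw (\<lambda>p. lo + hi - p) {p\<in>P. lo \<le> p \<and> p < ?s} {p\<in>B. y < p}"
    proof (rule bij_betw_byWitness[where f' = "\<lambda>p. lo + hi - p"])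
      show "(\<lambda>p. lo + hi - p) ` {p\<in>P. lo \<le> p \<and> p < ?s} \<subseteq> {p\<in>B. y < p}"
      proof clarify
        fix z assume "z \<in> P" "lo \<le> z" "z < ?s"
        then show "lo + hi - z \<in> B \<and> y < lo + hi - z"
          using BB[of z] s by (simp add: B_def)
      qed
      show "(\<lambda>p. lo + hi - p) ` {p\<in>B. y < p} \<subseteq> {p\<in>P. lo \<le> p \<and> p < ?s}"
      proof clarify
        fix z assume "z \<in> B" "y < z"
        then show "lo + hi - z \<in> P \<and> lo \<le> lo + hi - z \<and> lo + hi - z < ?s"
          using BB[of z] by (simp add: B_def)
      qed
    qed auto
    then have 3: "card {p\<in>P. lo \<le> p \<and> p < ?s} = card {p\<in>B. y < p}"
      by (rule bij_betw_same_card)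
    have "B = {p\<in>B. y < p} \<union> insert y {p\<in>P. lo \<le> p \<and> p < y}"
      using y by (auto simp: B_def)
    then have "card B = card ({p\<in>B. y < p} \<union> insert y {p\<in>P. lo \<le> p \<and> p < y})"
      by simp
    also have "\<dots> = card {p\<in>B. y < p} + card (insert y {p\<in>P. lo \<le> p \<and> p < y})"
      using fin finB by (intro card_Un_disjoint) auto
    also have "\<dots> = card {p\<in>B. y < p} + Suc (card {p\<in>P. lo \<le> p \<and> p < y})"
      using fin by simp
    finally show ?thesis using 1 2 3 by simp
  qed
  fix u v assume uv: "odd_gap P u v" and u: "lo \<le> u" "u < hi"
  have uP: "u \<in> P" and vP: "v \<in> P" and eu: "even (below_count P u)" and rv: "below_count P v = Suc (below_count P u)"
    using uv by (auto simp: odd_gap_def)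
  have luv: "u < v" using below_count_less_iff[OF fin uP, of v] rv by simp
  \<comment> \<open>Two different even numbers are not consecutive, so there is room for
    \<open>v\<close> before the block ends.\<close>
  have "below_count P u < below_count P hi" using below_count_less_iff[OF fin uP, of hi] u by simp
  then have "below_count P v < below_count P hi" using evhi eu rv
    by (metis Suc_lessI even_Suc)
  then have vh: "v < hi" using below_count_less_iff[OF fin vP] by simp
  have uB: "u \<in> B" and vB: "v \<in> B" using u vh luv uP vP by (auto simp: B_def)
  have "even (below_count P (lo + hi - v))" "below_count P (lo + hi - u) = Suc (below_count P (lo + hi - v))"
    using formula[OF uB] formula[OF vB] evB eu rv by presburger+
  moreover have "lo + hi - u \<in> P" "lo + hi - v \<in> P" using BB uB vB by (auto simp: B_def)
  ultimately show "v < hi \<and> odd_gap P (lo + hi - v) (lo + hi - u)"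
    using vh by (simp add: odd_gap_def)
qed

text \<open>The two least points of \<open>P\<close> have ranks 0 and 1; even cardinality guarantees
  that there is a second point.\<close>

lemma odd_gap_exist:
  assumes fin: "finite P" and ne: "P \<noteq> {}" and ev: "even (card P)"
  shows "\<exists>u v. odd_gap P u v"
proof -
  define u where "u = Min P"
  have u: "u \<in> P" "\<And>p. p \<in> P \<Longrightarrow> u \<le> p" using fin ne by (auto simp: u_def)
  have "P - {u} \<noteq> {}"
  proof
    assume "P - {u} = {}"
    then have "P = {u}" using u by auto
    then show False using ev by simp
  qed
  define v where "v = Min (P - {u})"
  have v: "v \<in> P - {u}" "\<And>p. p \<in> P - {u} \<Longrightarrow> v \<le> p"
    using fin \<open>P - {u} \<noteq> {}\<close> unfolding v_def by (metis Min_in finite_Diff, simp)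
  have "{p\<in>P. p < u} = {}" using u by force
  moreover have "{p\<in>P. p < v} = {u}" using u v by force
  ultimately have "below_count P u = 0" "below_count P v = 1" unfolding below_count_def by (simp_all only: card.empty) simp_all
  then have "odd_gap P u v" using u v by (simp add: odd_gap_def)
  then show ?thesis by blast
qed

lemma funpow_funpow: "(f ^^ a) ((f ^^ b) x) = (f ^^ (a + b)) x"
  by (simp add: funpow_add)

section \<open>The maps on the unit interval\<close>

locale sym_lengths =
  fixes lam :: "nat \<Rightarrow> real" and d :: nat
  assumes lam_pos: "i < d \<Longrightarrow> 0 < lam i" and lam_sum: "(\<Sum>i<d. lam i) = 1"
begin

abbreviation "idx \<equiv> piece_index lam d"
abbreviation "pt \<equiv> psum lam"

lemma pt_0 [simp]: "pt 0 = 0" and pt_Suc: "pt (Suc i) = pt i + lam i" and pt_d: "pt d = 1"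
  using lam_sum by (simp_all add: psum_def)

lemma pt_mono: "i \<le> j \<Longrightarrow> j \<le> d \<Longrightarrow> pt i \<le> pt j"
proof (induction rule: dec_induct)
  case (step n)
  then show ?case using lam_pos[of n] by (simp add: pt_Suc)
qed simp

lemma pt_less_Suc: "i < d \<Longrightarrow> pt i < pt (Suc i)"
  using lam_pos[of i] by (simp add: pt_Suc)

lemma pt_bounds: "i < d \<Longrightarrow> 0 \<le> pt i" "i < d \<Longrightarrow> pt (Suc i) \<le> 1"
  using pt_mono[of 0 i] pt_mono[of "Suc i" d] by (auto simp: pt_d)

lemma piece_unique:
  assumes "i < d" "j < d" "pt i \<le> y" "y < pt (Suc i)" "pt j \<le> y" "y < pt (Suc j)"
  shows "i = j"
proof (rule ccontr)
  assume "i \<noteq> j"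
  then consider "Suc i \<le> j" | "Suc j \<le> i" by linarith
  then show False
    using pt_mono[of "Suc i" j] pt_mono[of "Suc j" i] assms by cases auto
qed

lemma idx_eqI: "i < d \<Longrightarrow> pt i \<le> y \<Longrightarrow> y < pt (Suc i) \<Longrightarrow> idx y = i"
  unfolding piece_index_def elem_int_def
  by (rule the_equality) (auto intro: piece_unique)

lemma idx_props:
  assumes "0 \<le> y" "y < 1"
  shows "idx y < d" "pt (idx y) \<le> y" "y < pt (Suc (idx y))"
proof -
  \<comment> \<open>The piece of \<open>y\<close> ends at the first division point beyond
    \<open>y\<close>.\<close>
  define j where "j = (LEAST j. y < pt j)"
  have j: "y < pt j" unfolding j_def by (rule LeastI[of _ d]) (use assms pt_d in simp)
  have jd: "j \<le> d" unfolding j_def by (rule Least_le) (use assms pt_d in simp)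
  obtain i where i: "j = Suc i" using j assms by (cases j) auto
  have "\<not> y < pt i" using not_less_Least[of i "\<lambda>j. y < pt j"] i unfolding j_def by simp
  then have "idx y = i" using i j jd by (intro idx_eqI) auto
  then show "idx y < d" "pt (idx y) \<le> y" "y < pt (Suc (idx y))"
    using i j jd \<open>\<not> y < pt i\<close> by auto
qed

text \<open>In this form the translation is visibly the reversal of the piece followed by
  \<open>y\<close> going to \<open>1 - y\<close>.\<close>

lemma sym_omega_eq:
  assumes "i < d"
  shows "sym_omega lam d i = 1 - pt i - pt (Suc i)"
proof -
  have "(\<Sum>j<d. lam j) = (\<Sum>j<Suc i. lam j) + (\<Sum>j\<in>{Suc i..<d}. lam j)"
    using sum.atLeastLessThan_concat[of 0 "Suc i" d lam] assms by (simp add: lessThan_atLeast0)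
  then show ?thesis by (simp add: sym_omega_def psum_def lam_sum)
qed

section \<open>The involutions R and S and their product in the coordinate
  \<open>x - \<theta>0\<close> modulo 1\<close>

definition flip :: "real \<Rightarrow> real" where
  "flip y = pt (idx y) + pt (Suc (idx y)) - y"

text \<open>This is R when \<open>\<tau> = \<theta>1 - \<theta>0\<close>; the interval case is
  \<open>\<tau> = 0\<close>. The S of the overview is \<open>flip\<close>, and F becomes
  \<open>G\<close>.\<close>

definition rho :: "real \<Rightarrow> real \<Rightarrow> real" where
  "rho \<tau> y = frac (\<tau> - y)"

definition G :: "real \<Rightarrow> real \<Rightarrow> real" where
  "G \<tau> y = frac (y + sym_omega lam d (idx y) + \<tau>)"

text \<open>The left end of a piece is the point that \<open>flip\<close> throws out of the piece.\<close>

definition regular :: "real \<Rightarrow> bool" where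
  "regular y \<longleftrightarrow> 0 \<le> y \<and> y < 1 \<and> y \<noteq> pt (idx y)"

lemma regular_flip:
  assumes "regular y"
  shows "regular (flip y)" "idx (flip y) = idx y" "flip (flip y) = y"
proof -
  have y: "idx y < d" "pt (idx y) < y" "y < pt (Suc (idx y))"
    using idx_props[of y] assms unfolding regular_def by auto
  have b: "pt (idx y) < flip y" "flip y < pt (Suc (idx y))" using y by (auto simp: flip_def)
  show i: "idx (flip y) = idx y" using y b by (intro idx_eqI) auto
  show "flip (flip y) = y" using i by (simp add: flip_def)
  show "regular (flip y)" unfolding regular_def i
    using b pt_bounds[of "idx y"] y by auto
qed

lemma rho_rho: "0 \<le> y \<Longrightarrow> y < 1 \<Longrightarrow> rho \<tau> (rho \<tau> y) = y"
  unfolding rho_def frac_unique_iff by (simp add: frac_def)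

text \<open>The factorization F = R S. The summand 1 of \<open>sym_omega_eq\<close> disappears
  modulo 1, and left ends of pieces need no exception here.\<close>

lemma G_eq: "0 \<le> y \<Longrightarrow> y < 1 \<Longrightarrow> G \<tau> y = rho \<tau> (flip y)"
proof -
  assume "0 \<le> y" "y < 1"
  then have "sym_omega lam d (idx y) = 1 - pt (idx y) - pt (Suc (idx y))"
    using idx_props sym_omega_eq by blast
  then have "y + sym_omega lam d (idx y) + \<tau> = (\<tau> - flip y) + 1"
    by (simp add: flip_def)
  then show ?thesis unfolding G_def rho_def by (simp only: frac_1_eq)
qed

text \<open>Every piece is a block reversed by \<open>flip\<close>. Going through the pieces from
  left to right, \<open>block_reflect\<close> shows that an even number of points precedes each
  division point, so no couple is split by one.\<close>

lemma flip_gap: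
  assumes fin: "finite P" and reg: "\<And>y. y \<in> P \<Longrightarrow> regular y"
    and flip: "\<And>y. y \<in> P \<Longrightarrow> flip y \<in> P \<and> flip y \<noteq> y"
  shows "even (card P)"
    and "\<And>u v. odd_gap P u v \<Longrightarrow> idx v = idx u \<and> odd_gap P (flip v) (flip u)"
proof -
  have refl: "pt i + pt (Suc i) - y \<in> P \<and> y \<noteq> pt i \<and> 2 * y \<noteq> pt i + pt (Suc i)"
    if "i < d" "y \<in> P" "pt i \<le> y" "y < pt (Suc i)" for i y
  proof -
    have "idx y = i" using that by (intro idx_eqI)
    then show ?thesis using flip[of y] reg[of y] that by (auto simp: flip_def regular_def)
  qed
  have ev: "even (below_count P (pt i))" if "i \<le> d" for i
    using that
  proof (induction i)
    case 0
    have none: "{y\<in>P. y < 0} = {}" using reg by (force simp: regular_def)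
    show ?case unfolding below_count_def pt_0 none by simp
  next
    case (Suc i)
    then have "i < d" by simp
    show ?case
      by (rule block_reflect(1)[where lo = "pt i"])
        (use Suc fin refl[OF \<open>i < d\<close>] pt_less_Suc in \<open>auto intro: less_imp_le\<close>)
  qed
  have "{y\<in>P. y < 1} = P" using reg by (auto simp: regular_def)
  then show "even (card P)" using ev[of d] by (simp add: below_count_def pt_d)
  fix u v assume uv: "odd_gap P u v"
  then have "u \<in> P" "v \<in> P" by (auto simp: odd_gap_def)
  define i where "i = idx u"
  have i: "i < d" "pt i \<le> u" "u < pt (Suc i)"
    using idx_props[of u] reg[OF \<open>u \<in> P\<close>] by (auto simp: i_def regular_def)
  have v: "v < pt (Suc i)" and gap: "odd_gap P (pt i + pt (Suc i) - v) (pt i + pt (Suc i) - u)"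
    using block_reflect(2)[OF fin less_imp_le[OF pt_less_Suc[OF i(1)]] ev[of i] _ uv i(2,3)] refl[OF i(1)] i(1)
    by auto
  have "u < v" using uv below_count_less_iff[OF fin \<open>u \<in> P\<close>, of v] by (simp add: odd_gap_def)
  then have "idx v = i" using i v by (intro idx_eqI) auto
  then show "idx v = idx u \<and> odd_gap P (flip v) (flip u)"
    using gap by (simp add: flip_def i_def)
qed

text \<open>Modulo 1 the reflection reverses the two blocks from 0 to \<open>f\<close> and from
  \<open>f\<close> to 1 separately, where \<open>f = frac \<tau>\<close>. The cut \<open>f\<close>
  is not in \<open>P\<close>, since it would be reflected to 0, the left end of the first piece. A
  couple stays within one block, so no wrap-around disturbs its length.\<close>

lemma rho_gap:
  assumes fin: "finite P" and reg: "\<And>y. y \<in> P \<Longrightarrow> regular y"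
    and rho: "\<And>y. y \<in> P \<Longrightarrow> rho \<tau> y \<in> P \<and> rho \<tau> y \<noteq> y"
    and uv: "odd_gap P u v"
  shows "odd_gap P (rho \<tau> v) (rho \<tau> u)" "rho \<tau> u - rho \<tau> v = v - u"
proof -
  define f where "f = frac \<tau>"
  have f: "0 \<le> f" "f < 1" by (auto simp: f_def frac_lt_1)
  have Pb: "0 \<le> y" "y < 1" if "y \<in> P" for y using reg[OF that] by (auto simp: regular_def)
  have zero: "0 \<notin> P"
  proof
    assume "0 \<in> P"
    have "0 < d" using lam_sum by (cases d) auto
    then have "idx 0 = 0" using pt_less_Suc[of 0] by (intro idx_eqI) auto
    then show False using reg[OF \<open>0 \<in> P\<close>] by (simp add: regular_def)
  qed
  have rho1: "rho \<tau> y = f - y" if "y \<le> f" "0 \<le> y" for y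
    unfolding rho_def frac_unique_iff using that f by (auto simp: f_def frac_def)
  have rho2: "rho \<tau> y = f + 1 - y" if "f < y" "y < 1" for y
  proof -
    have "\<tau> - y - (f + 1 - y) = of_int (\<lfloor>\<tau>\<rfloor> - 1)" by (simp add: f_def frac_def)
    then have "\<tau> - y - (f + 1 - y) \<in> \<int>" by (metis Ints_of_int)
    then show ?thesis unfolding rho_def frac_unique_iff using that f by simp
  qed
  have fP: "f \<notin> P" using rho1[of f] rho[of f] zero f by auto
  have r1: "0 + f - y \<in> P \<and> y \<noteq> 0 \<and> 2 * y \<noteq> 0 + f" if "y \<in> P" "0 \<le> y" "y < f" for y
    using rho1[of y] rho[of y] zero that by auto
  have r2: "f + 1 - y \<in> P \<and> y \<noteq> f \<and> 2 * y \<noteq> f + 1" if "y \<in> P" "f \<le> y" "y < 1" for y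
  proof -
    have "y \<noteq> f" using fP that by auto
    then show ?thesis using rho2[of y] rho[of y] that by auto
  qed
  have none: "{y\<in>P. y < 0} = {}" using Pb by force
  have ev0: "even (below_count P 0)" unfolding below_count_def none by simp
  have ev1: "even (below_count P f)"
    by (rule block_reflect(1)[OF fin f(1) ev0]) (use r1 in blast)
  have b1: "v < f \<and> odd_gap P (0 + f - v) (0 + f - u)" if "0 \<le> u" "u < f"
    by (rule block_reflect(2)[OF fin f(1) ev0 _ uv that]) (use r1 in blast)
  have b2: "v < 1 \<and> odd_gap P (f + 1 - v) (f + 1 - u)" if "f \<le> u" "u < 1"
    by (rule block_reflect(2)[OF fin less_imp_le[OF f(2)] ev1 _ uv that]) (use r2 in blast)
  have uP: "u \<in> P" and vP: "v \<in> P" using uv by (auto simp: odd_gap_def)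
  have luv: "u < v" using uv below_count_less_iff[OF fin uP, of v] by (simp add: odd_gap_def)
  have "odd_gap P (rho \<tau> v) (rho \<tau> u) \<and> rho \<tau> u - rho \<tau> v = v - u"
  proof (cases "u < f")
    case True
    with b1 Pb[OF uP] have "v < f" "odd_gap P (f - v) (f - u)" by auto
    then show ?thesis using rho1[of u] rho1[of v] True Pb uP vP by auto
  next
    case False
    with b2 Pb[OF uP] have "odd_gap P (f + 1 - v) (f + 1 - u)" by auto
    moreover have "f < u" using False fP uP by (metis linorder_neqE_linordered_idom)
    ultimately show ?thesis using rho2[of u] rho2[of v] luv Pb uP vP by auto
  qed
  then show "odd_gap P (rho \<tau> v) (rho \<tau> u)" "rho \<tau> u - rho \<tau> v = v - u" by auto
qed

section \<open>The orbit of a point and the orbit of its reflection\<close>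

lemma rho_G:
  assumes "regular y"
  shows "rho \<tau> (G \<tau> y) = flip y"
  using assms regular_flip(1)[OF assms] by (simp add: G_eq rho_rho regular_def)

text \<open>Since R F = S and S is an involution, F R F = R S S = R: the reflection reverses
  time.\<close>

lemma G_rho_G:
  assumes "regular y"
  shows "G \<tau> (rho \<tau> (G \<tau> y)) = rho \<tau> y"
  using regular_flip[OF assms] by (simp add: rho_G[OF assms] G_eq regular_def)

lemma funpow_G_rho:
  assumes "\<And>k. regular ((G \<tau> ^^ k) y)"
  shows "(G \<tau> ^^ k) (rho \<tau> ((G \<tau> ^^ k) y)) = rho \<tau> y"
proof (induction k)
  case (Suc k)
  have "(G \<tau> ^^ Suc k) (rho \<tau> ((G \<tau> ^^ Suc k) y)) = (G \<tau> ^^ k) (G \<tau> (rho \<tau> (G \<tau> ((G \<tau> ^^ k) y))))"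
    by (simp add: funpow_swap1)
  also have "\<dots> = rho \<tau> y" using G_rho_G[OF assms] Suc by simp
  finally show ?case .
qed simp

text \<open>The second clause says that the two orbits are never separated by the point where the circle
  is cut open, so that the lifts of the orbits stay in the same lifted pieces.\<close>

definition parallel :: "real \<Rightarrow> real \<Rightarrow> real \<Rightarrow> bool" where
  "parallel \<tau> u v \<longleftrightarrow> (\<forall>k. idx ((G \<tau> ^^ k) u) = idx ((G \<tau> ^^ k) v) \<and>
     (G \<tau> ^^ k) u - (G \<tau> ^^ k) v = u - v)"

lemma parallel_sym: "parallel \<tau> u v \<Longrightarrow> parallel \<tau> v u"
  unfolding parallel_def by (metis minus_diff_eq)

lemma parallel_funpow: "parallel \<tau> u v \<Longrightarrow> parallel \<tau> ((G \<tau> ^^ k) u) ((G \<tau> ^^ k) v)"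
  unfolding parallel_def by (simp add: funpow_funpow)

text \<open>If the orbit \<open>O1\<close> meets its reflection \<open>O2\<close>, then
  \<open>rho \<tau> x\<close> itself lies on the orbit. Otherwise \<open>flip\<close> and
  \<open>rho \<tau>\<close> both exchange \<open>O1\<close> and \<open>O2\<close>, hence have no
  fixed points on the union, and the gap lemmas apply. Each of them turns an odd gap around, so
  \<open>G\<close> carries odd gaps to odd gaps with orientation and length preserved.\<close>

lemma rho_orbit_parallel:
  assumes q: "0 < q" "(G \<tau> ^^ q) x = x" and reg: "\<And>k. regular ((G \<tau> ^^ k) x)"
  shows "\<exists>m. parallel \<tau> (rho \<tau> x) ((G \<tau> ^^ m) x)"
proof -
  define O1 where "O1 = range (\<lambda>k. (G \<tau> ^^ k) x)"
  define O2 where "O2 = rho \<tau> ` O1"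
  define P where "P = O1 \<union> O2"
  have O1I: "(G \<tau> ^^ k) x \<in> O1" for k by (auto simp: O1_def)
  have reg1: "regular y" "0 \<le> y" "y < 1" if "y \<in> O1" for y
    using that reg by (auto simp: O1_def regular_def)
  have G1: "G \<tau> y \<in> O1" if "y \<in> O1" for y
    using that O1I[of "Suc _"] by (auto simp: O1_def)
  have G1': "\<exists>w\<in>O1. y = G \<tau> w" if y: "y \<in> O1" for y
  proof -
    obtain k where k: "y = (G \<tau> ^^ k) x" using y by (auto simp: O1_def)
    \<comment> \<open>On a periodic orbit a predecessor is reached by going \<open>q - 1\<close>
      steps forward.\<close>
    have "(G \<tau> ^^ Suc (k + (q - 1))) x = (G \<tau> ^^ k) ((G \<tau> ^^ q) x)"
      using q by (simp add: funpow_add del: funpow.simps)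
    then show ?thesis using k q O1I by (metis comp_apply funpow.simps(2))
  qed
  have "O1 \<subseteq> (\<lambda>k. (G \<tau> ^^ k) x) ` {..<q}"
    unfolding O1_def using q by (force simp: funpow_mod_eq intro!: image_eqI[where x = "_ mod q"])
  then have "finite O1" using finite_subset by blast
  then have fin: "finite P" by (simp add: P_def O2_def)
  have flip1: "flip y \<in> O2" if "y \<in> O1" for y
    using G1[OF that] rho_G[OF reg1(1)[OF that]] unfolding O2_def by (metis imageI)
  \<comment> \<open>Regularity is preserved by \<open>flip\<close> but not in general by
    \<open>rho\<close>, so points of \<open>O2\<close> are rewritten as flipped points of
    \<open>O1\<close>.\<close>
  have flip2: "\<exists>w\<in>O1. y = flip w" if y: "y \<in> O2" for y
  proof -
    obtain w where w: "w \<in> O1" "y = rho \<tau> (G \<tau> w)" using y G1' by (auto simp: O2_def)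
    then show ?thesis using rho_G[OF reg1(1)[OF w(1)]] by auto
  qed
  have reg2: "regular y" if "y \<in> O2" for y using flip2[OF that] regular_flip(1) reg1 by auto
  have regP: "regular y" if "y \<in> P" for y using that reg1 reg2 by (auto simp: P_def)
  have flip2': "flip y \<in> O1" if "y \<in> O2" for y using flip2[OF that] regular_flip(3) reg1 by auto
  have rho1: "rho \<tau> y \<in> O2" if "y \<in> O1" for y using that by (auto simp: O2_def)
  have rho2: "rho \<tau> y \<in> O1" if "y \<in> O2" for y using that reg1 by (auto simp: O2_def rho_rho)
  have unwind: "(G \<tau> ^^ b) (rho \<tau> ((G \<tau> ^^ b) x)) = rho \<tau> x" for b
    by (rule funpow_G_rho) (rule reg)
  show ?thesis
  proof (cases "O1 \<inter> O2 = {}")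
    case False
    then obtain a b where "(G \<tau> ^^ a) x = rho \<tau> ((G \<tau> ^^ b) x)" by (auto simp: O1_def O2_def)
    then have "rho \<tau> x = (G \<tau> ^^ (b + a)) x" using unwind[of b] by (simp add: funpow_add)
    then show ?thesis by (auto simp: parallel_def)
  next
    case True
    have flipP: "flip y \<in> P \<and> flip y \<noteq> y" if "y \<in> P" for y
      using that True flip1[of y] flip2'[of y] unfolding P_def by (metis IntI Un_iff empty_iff)
    have rhoP: "rho \<tau> y \<in> P \<and> rho \<tau> y \<noteq> y" if "y \<in> P" for y
      using that True rho1[of y] rho2[of y] unfolding P_def by (metis IntI Un_iff empty_iff)
    have step: "odd_gap P (G \<tau> u) (G \<tau> v) \<and> idx u = idx v \<and> G \<tau> u - G \<tau> v = u - v"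
      if uv: "odd_gap P u v" for u v
    proof -
      have P: "u \<in> P" "v \<in> P" using uv by (auto simp: odd_gap_def)
      have s: "idx v = idx u" "odd_gap P (flip v) (flip u)"
        using flip_gap(2)[OF fin regP flipP uv] by auto
      have "odd_gap P (rho \<tau> (flip u)) (rho \<tau> (flip v))"
        "rho \<tau> (flip v) - rho \<tau> (flip u) = flip u - flip v"
        using rho_gap[OF fin regP rhoP s(2)] by auto
      then show ?thesis using s(1) regP[OF P(1)] regP[OF P(2)]
        by (simp add: G_eq regular_def flip_def)
    qed
    have "even (card P)" by (rule flip_gap(1)[OF fin regP flipP])
    moreover have "P \<noteq> {}" by (auto simp: P_def O1_def)
    ultimately obtain u v where uv: "odd_gap P u v" using odd_gap_exist[OF fin] by blast
    have iter: "odd_gap P ((G \<tau> ^^ k) u) ((G \<tau> ^^ k) v) \<and> (G \<tau> ^^ k) u - (G \<tau> ^^ k) v = u - v" for k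
      by (induction k) (use uv step in auto)
    have par: "parallel \<tau> u v" unfolding parallel_def using iter step by blast
    \<comment> \<open>\<open>G\<close> maps left ends of odd gaps to left ends, and the parity of the rank tells the two ends
      apart, so the two ends lie on different orbits.\<close>
    have noret: "(G \<tau> ^^ k) u \<noteq> v" "(G \<tau> ^^ k) v \<noteq> u" for k
      using iter[of k] uv unfolding odd_gap_def by (metis even_Suc)+
    have conn: "\<exists>k. (G \<tau> ^^ k) y = z" if yz: "y \<in> O1" "z \<in> O1" for y z
    proof -
      obtain a b where ab: "y = (G \<tau> ^^ a) x" "z = (G \<tau> ^^ b) x" using yz by (auto simp: O1_def)
      have per: "(G \<tau> ^^ (q * n)) x = x" for n
        using funpow_mod_eq[OF q(2), of "q * n"] by simp
      have "a \<le> q * a" using q by simp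
      \<comment> \<open>The first \<open>q * a - a\<close> steps complete \<open>a\<close> full
        periods and return from \<open>y\<close> to \<open>x\<close>; \<open>b\<close> more lead to
        \<open>z\<close>.\<close>
      then have "(G \<tau> ^^ (b + (q * a - a))) y = (G \<tau> ^^ b) ((G \<tau> ^^ (q * a)) x)"
        unfolding ab funpow_funpow by (metis add.assoc le_add_diff_inverse2)
      then show ?thesis using per ab by auto
    qed
    \<comment> \<open>Time reversal: a path from the reflection of \<open>z\<close> to that of
      \<open>y\<close> gives a path of the same length from \<open>y\<close> to
      \<open>z\<close>.\<close>
    have conn2: "\<exists>k. (G \<tau> ^^ k) y = z" if yz: "y \<in> O2" "z \<in> O2" for y z
    proof -
      have ry: "rho \<tau> y \<in> O1" "rho \<tau> z \<in> O1" using rho2 yz by auto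
      obtain k where k: "(G \<tau> ^^ k) (rho \<tau> z) = rho \<tau> y" using conn ry by blast
      obtain j where j: "rho \<tau> z = (G \<tau> ^^ j) x" using ry by (auto simp: O1_def)
      have "regular ((G \<tau> ^^ i) (rho \<tau> z))" for i
        unfolding j using reg[of "i + j"] by (simp add: funpow_add)
      then have "(G \<tau> ^^ k) (rho \<tau> ((G \<tau> ^^ k) (rho \<tau> z))) = rho \<tau> (rho \<tau> z)"
        by (rule funpow_G_rho)
      then have "(G \<tau> ^^ k) y = z" unfolding k
        using reg2[OF yz(1)] reg2[OF yz(2)] by (simp add: rho_rho regular_def)
      then show ?thesis by blast
    qed
    \<comment> \<open>Advancing both points by \<open>b\<close> steps turns the reflection of
      \<open>(G \<tau> ^^ b) x\<close> into that of \<open>x\<close>, by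
      \<open>unwind\<close>.\<close>
    have main: "\<exists>m. parallel \<tau> (rho \<tau> x) ((G \<tau> ^^ m) x)"
      if yz: "parallel \<tau> y z" "y \<in> O2" "z \<in> O1" for y z
    proof -
      obtain a b where ab: "z = (G \<tau> ^^ a) x" "y = rho \<tau> ((G \<tau> ^^ b) x)"
        using yz by (auto simp: O1_def O2_def)
      have "parallel \<tau> ((G \<tau> ^^ b) y) ((G \<tau> ^^ b) z)" using yz(1) by (rule parallel_funpow)
      then have "parallel \<tau> (rho \<tau> x) ((G \<tau> ^^ (b + a)) x)"
        unfolding ab unwind by (simp add: funpow_add)
      then show ?thesis by blast
    qed
    have "u \<in> P" "v \<in> P" using uv by (auto simp: odd_gap_def)
    then consider "u \<in> O1" "v \<in> O1" | "u \<in> O2" "v \<in> O2" | "u \<in> O2" "v \<in> O1" | "v \<in> O2" "u \<in> O1"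
      by (auto simp: P_def)
    then show ?thesis
    proof cases
      case 1 then show ?thesis using conn noret by blast
    next
      case 2 then show ?thesis using conn2 noret by blast
    next
      case 3 then show ?thesis using main par by blast
    next
      case 4 then show ?thesis using main parallel_sym[OF par] by blast
    qed
  qed
qed

end

section \<open>Lifts to the real line\<close>

text \<open>Otherwise the points \<open>x + k s\<close> would leave every bounded set. This is what
  makes the return map of a periodic interval the identity.\<close>

lemma bounded_translation_zero:
  fixes s :: real
  assumes "x \<in> I" "I \<subseteq> {a..b}" and step: "\<And>y. y \<in> I \<Longrightarrow> y + s \<in> I"
  shows "s = 0"
proof (rule ccontr)
  assume s: "s \<noteq> 0"
  have iter: "x + real k * s \<in> I" for k
  proof (induction k)
    case (Suc k)
    then show ?case using step[OF Suc] by (simp add: algebra_simps)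
  qed (use assms in simp)
  obtain k where k: "b - a < real k * \<bar>s\<bar>" using s reals_Archimedean3[of "\<bar>s\<bar>"] by auto
  have "x + real k * s \<in> {a..b}" "x \<in> {a..b}" using iter assms(1,2) by blast+
  then have "\<bar>real k * s\<bar> \<le> b - a" by auto
  then show False using k by (simp add: abs_mult)
qed

text \<open>A reflection preserves length, so it can send an interval into its own closure only by
  turning it around its midpoint.\<close>

lemma reflected_interval:
  fixes a b s :: real
  assumes "a < b" and I: "\<And>z. a < z \<Longrightarrow> z < b \<Longrightarrow> a \<le> s - z \<and> s - z \<le> b"
  shows "s = a + b"
proof (rule ccontr)
  assume "s \<noteq> a + b"
  then consider "s < a + b" | "s > a + b" by linarith
  then show False
  proof cases
    case 1
    then have "max a (s - a) < b" using assms by auto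
    then obtain z where "max a (s - a) < z" "z < b" using dense by blast
    then show False using I[of z] by auto
  next
    case 2
    then have "a < min b (s - b)" using assms by auto
    then obtain z where "a < z" "z < min b (s - b)" using dense by blast
    then show False using I[of z] by auto
  qed
qed

locale sym_rotation = sym_lengths +
  fixes \<theta>0 \<theta>1 :: real
begin

abbreviation "F \<equiv> sym_cem lam d \<theta>0 \<theta>1"
abbreviation "R \<equiv> cem_refl \<theta>0 \<theta>1"

text \<open>An arc is recorded through its lift, so two points in different lifts of the same piece
  must be told apart: the intersection of two arcs of the circle may be disconnected.\<close>

definition cell :: "real \<Rightarrow> nat \<times> int" where
  "cell y = (idx (frac (y - \<theta>0)), \<lfloor>y - \<theta>0\<rfloor>)"

definition follow :: "real \<Rightarrow> real \<Rightarrow> bool" where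
  "follow u v \<longleftrightarrow> (\<forall>k. cell ((F ^^ k) u) = cell ((F ^^ k) v))"

lemma cell_bounds:
  assumes "cell y = (i, n)"
  shows "i < d" "\<theta>0 + of_int n + pt i \<le> y" "y < \<theta>0 + of_int n + pt (Suc i)"
  using assms idx_props[of "frac (y - \<theta>0)"] frac_lt_1[of "y - \<theta>0"]
  by (auto simp: cell_def) (auto simp: frac_def)

lemma cell_eqI:
  assumes "i < d" "\<theta>0 + of_int n + pt i \<le> y" "y < \<theta>0 + of_int n + pt (Suc i)"
  shows "cell y = (i, n)"
proof -
  have "\<lfloor>y - \<theta>0\<rfloor> = n" using assms pt_bounds[OF assms(1)] by (intro floor_unique) auto
  moreover have "idx (frac (y - \<theta>0)) = i"
    using assms calculation by (intro idx_eqI) (auto simp: frac_def)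
  ultimately show ?thesis by (simp add: cell_def)
qed

lemma cell_less_d: "fst (cell y) < d"
  using cell_bounds(1)[of y] by (metis prod.collapse)

lemma cell_between:
  assumes "cell u = cell v" "u \<le> w" "w \<le> v"
  shows "cell w = cell u"
proof -
  obtain i n where u: "cell u = (i, n)" by fastforce
  then have "cell v = (i, n)" using assms(1) by simp
  then have "cell w = (i, n)"
    using cell_bounds[OF u] cell_bounds(3)[of v i n] assms(2,3) by (intro cell_eqI) auto
  then show ?thesis using u by simp
qed

lemma F_cell: "F y = y + sym_omega lam d (fst (cell y)) - \<theta>0 + \<theta>1"
  by (simp add: sym_cem_def cell_def)

lemma cell_add_int: "cell (y + of_int n) = (fst (cell y), snd (cell y) + n)"
proof -
  have "y + of_int n - \<theta>0 = (y - \<theta>0) + of_int n" by simp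
  then show ?thesis unfolding cell_def by (simp only: frac_add_of_int_right) simp
qed

lemma F_add_int: "F (y + of_int n) = F y + of_int n"
  by (simp add: F_cell cell_add_int)

lemma funpow_F_add_int: "(F ^^ k) (y + of_int n) = (F ^^ k) y + of_int n"
  by (induction k) (simp_all add: F_add_int)

text \<open>A semiconjugacy from the lift to \<open>G\<close>, through which
  \<open>rho_orbit_parallel\<close> reaches the line.\<close>

lemma frac_F: "frac (F y - \<theta>0) = G (\<theta>1 - \<theta>0) (frac (y - \<theta>0))"
proof -
  have "F y - \<theta>0 = (frac (y - \<theta>0) + sym_omega lam d (idx (frac (y - \<theta>0))) + (\<theta>1 - \<theta>0)) + of_int \<lfloor>y - \<theta>0\<rfloor>"
    by (simp add: sym_cem_def frac_def)
  then show ?thesis unfolding G_def by (simp only: frac_add_of_int_right)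
qed

lemma frac_funpow_F: "frac ((F ^^ k) y - \<theta>0) = (G (\<theta>1 - \<theta>0) ^^ k) (frac (y - \<theta>0))"
  by (induction k) (simp_all add: frac_F)

lemma frac_R: "frac (R y - \<theta>0) = rho (\<theta>1 - \<theta>0) (frac (y - \<theta>0))"
  unfolding rho_def frac_diff_simp by (simp add: cem_refl_def algebra_simps)

lemma R_add_int: "R (y + of_int n) = R y - of_int n"
  by (simp add: cem_refl_def)

section \<open>Classes of points with the same itinerary\<close>

lemma funpow_same_index:
  assumes "\<And>k. fst (cell ((F ^^ k) u)) = fst (cell ((F ^^ k) v))"
  shows "(F ^^ k) u - (F ^^ k) v = u - v"
proof (induction k)
  case (Suc k)
  then show ?case
    using assms[of k] F_cell[of "(F ^^ k) u"] F_cell[of "(F ^^ k) v"] by simp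
qed simp

lemma follow_diff: "follow u v \<Longrightarrow> (F ^^ k) u - (F ^^ k) v = u - v"
  by (rule funpow_same_index) (simp add: follow_def)

lemma follow_sym: "follow u v \<Longrightarrow> follow v u"
  by (simp add: follow_def)

lemma follow_trans: "follow u v \<Longrightarrow> follow v w \<Longrightarrow> follow u w"
  by (simp add: follow_def)

lemma follow_funpow: "follow u v \<Longrightarrow> follow ((F ^^ k) u) ((F ^^ k) v)"
  by (simp add: follow_def funpow_funpow)

lemma follow_add_int: "follow (u + of_int n) (v + of_int n) \<longleftrightarrow> follow u v"
  unfolding follow_def funpow_F_add_int cell_add_int by (auto simp: prod_eq_iff)

text \<open>As long as the three points share a cell they are translated by the same vector, so
  \<open>w\<close> stays between the other two; cells are intervals, so the next cell is shared
  again.\<close>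

lemma follow_between:
  assumes "follow u v" "u \<le> w" "w \<le> v"
  shows "follow w u"
proof -
  have "(F ^^ k) w - (F ^^ k) u = w - u \<and> cell ((F ^^ k) w) = cell ((F ^^ k) u)" for k
  proof (induction k)
    case 0
    then show ?case using cell_between[OF _ assms(2,3)] assms(1) unfolding follow_def
      by (metis funpow_0)
  next
    case (Suc k)
    then have *: "(F ^^ Suc k) w - (F ^^ Suc k) u = w - u"
      using F_cell[of "(F ^^ k) w"] F_cell[of "(F ^^ k) u"] by simp
    have "(F ^^ Suc k) u - (F ^^ Suc k) v = u - v" using follow_diff[OF assms(1)] .
    then have le: "(F ^^ Suc k) u \<le> (F ^^ Suc k) w" "(F ^^ Suc k) w \<le> (F ^^ Suc k) v"
      using * assms(2,3) by linarith+
    then have "cell ((F ^^ Suc k) w) = cell ((F ^^ Suc k) u)"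
      using cell_between[OF _ le] assms(1) unfolding follow_def by blast
    with * show ?case by blast
  qed
  then show ?thesis by (simp add: follow_def)
qed

lemma is_interval_follow: "is_interval {z. follow z x}"
  unfolding is_interval_1 using follow_between follow_sym follow_trans
  by (metis mem_Collect_eq)

lemma follow_bounds:
  assumes "follow z x"
  shows "\<theta>0 + of_int (snd (cell x)) + pt (fst (cell x)) \<le> z" "z < \<theta>0 + of_int (snd (cell x)) + pt (Suc (fst (cell x)))"
proof -
  have "cell z = (fst (cell x), snd (cell x))" using assms by (auto simp: follow_def dest: spec[of _ 0])
  then show "\<theta>0 + of_int (snd (cell x)) + pt (fst (cell x)) \<le> z" "z < \<theta>0 + of_int (snd (cell x)) + pt (Suc (fst (cell x)))"
    using cell_bounds by auto
qed

text \<open>The lifted form of R F = S. Regularity makes the left inequality strict, so that the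
  reversed point stays in piece \<open>i\<close>. The lift number becomes \<open>- n - 1\<close>,
  the 1 being the summand in \<open>sym_omega_eq\<close> that is invisible modulo 1.\<close>

lemma F_R_F:
  assumes "regular (frac (z - \<theta>0))"
  shows "F (R (F z)) = R z" "cell (R (F z)) = (fst (cell z), - snd (cell z) - 1)"
proof -
  obtain i n where c: "cell z = (i, n)" by fastforce
  have b: "i < d" "\<theta>0 + of_int n + pt i \<le> z" "z < \<theta>0 + of_int n + pt (Suc i)"
    using cell_bounds[OF c] by auto
  have "frac (z - \<theta>0) \<noteq> pt i" using assms c by (auto simp: regular_def cell_def)
  moreover have "frac (z - \<theta>0) = z - \<theta>0 - of_int n" using c by (auto simp: cell_def frac_def)
  ultimately have b': "\<theta>0 + of_int n + pt i < z" using b by auto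
  have Fz: "F z = z + 1 - pt i - pt (Suc i) - \<theta>0 + \<theta>1"
    using c sym_omega_eq[OF b(1)] by (simp add: F_cell)
  have RF: "cell (R (F z)) = (i, - n - 1)"
    using b b' by (intro cell_eqI) (auto simp: cem_refl_def Fz)
  then show "cell (R (F z)) = (fst (cell z), - snd (cell z) - 1)" using c by simp
  show "F (R (F z)) = R z"
    using RF sym_omega_eq[OF b(1)] by (simp add: F_cell[of "R (F z)"]) (simp add: cem_refl_def Fz)
qed

lemma funpow_F_R_funpow_F:
  assumes "\<And>k. regular (frac ((F ^^ k) z - \<theta>0))"
  shows "(F ^^ k) (R ((F ^^ k) z)) = R z"
proof (induction k)
  case (Suc k)
  have "(F ^^ Suc k) (R ((F ^^ Suc k) z)) = (F ^^ k) (F (R (F ((F ^^ k) z))))"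
    by (simp add: funpow_swap1)
  also have "\<dots> = R z" using F_R_F(1)[OF assms] Suc by simp
  finally show ?case .
qed simp

lemma funpow_period:
  assumes "(F ^^ q) x = x + of_int n"
  shows "(F ^^ (k * q)) x = x + of_int (int k * n)"
proof (induction k)
  case (Suc k)
  have "(F ^^ (Suc k * q)) x = (F ^^ (k * q)) ((F ^^ q) x)"
    by (simp add: funpow_add add.commute[of q])
  then show ?case using Suc assms by (simp add: funpow_F_add_int algebra_simps)
qed simp

text \<open>Some \<open>F ^^ m\<close> takes \<open>x\<close> to a point that, up to an integer, has
  the itinerary of \<open>R x\<close>. As R respects the class of \<open>x\<close>, undoing
  \<open>F ^^ m\<close> after R reflects the open interval from \<open>a\<close> to \<open>b\<close>
  into its own class, hence about its midpoint. The conclusion compares left ends: that of the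
  reflected interval and that of the translated one.\<close>

lemma reflected_class:
  assumes ab: "a < x" "x < b" and fol: "\<And>z. a < z \<Longrightarrow> z < b \<Longrightarrow> follow z x"
    and sub: "\<And>z. follow z x \<Longrightarrow> a \<le> z \<and> z \<le> b"
    and q: "0 < q" "(F ^^ q) x = x + of_int n"
  shows "\<exists>m n'. \<theta>0 + \<theta>1 - b = a + ((F ^^ m) x - x) + of_int n'"
proof -
  \<comment> \<open>If an iterate of \<open>z\<close> were the left end of a cell, a point
    \<open>w\<close> of the class to the left of \<open>z\<close> would have left that cell.\<close>
  have reg: "regular (frac ((F ^^ k) z - \<theta>0))" if z: "a < z" "z < b" for k z
  proof -
    define w where "w = (a + z) / 2"
    have w: "a < w" "w < z" using z by (auto simp: w_def)
    then have "follow w z" using fol z follow_sym follow_trans by (meson less_trans)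
    then have c: "cell ((F ^^ k) w) = cell ((F ^^ k) z)" and "(F ^^ k) w - (F ^^ k) z = w - z"
      by (simp add: follow_def, simp add: follow_diff)
    then have less: "(F ^^ k) w < (F ^^ k) z" using w by linarith
    obtain i j where ij: "cell ((F ^^ k) z) = (i, j)" by fastforce
    have "\<theta>0 + of_int j + pt i \<le> (F ^^ k) w" using cell_bounds(2) c ij by metis
    moreover have "frac ((F ^^ k) z - \<theta>0) = (F ^^ k) z - \<theta>0 - of_int j"
      "idx (frac ((F ^^ k) z - \<theta>0)) = i"
      using ij by (auto simp: cell_def frac_def)
    ultimately have "frac ((F ^^ k) z - \<theta>0) \<noteq> pt (idx (frac ((F ^^ k) z - \<theta>0)))"
      using less by simp
    then show ?thesis by (simp add: regular_def frac_lt_1)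
  qed
  define \<tau> where "\<tau> = \<theta>1 - \<theta>0"
  define y where "y = frac (x - \<theta>0)"
  have "(G \<tau> ^^ q) y = y"
    using frac_funpow_F[of q x] q(2) unfolding \<tau>_def y_def
    by (metis add_diff_eq add_diff_cancel_right' diff_add_eq frac_add_of_int_right)
  moreover have "regular ((G \<tau> ^^ k) y)" for k
    using reg[OF ab, of k] by (simp add: frac_funpow_F \<tau>_def y_def)
  ultimately obtain m where m: "parallel \<tau> (rho \<tau> y) ((G \<tau> ^^ m) y)"
    using rho_orbit_parallel[OF q(1)] by blast
  have Ry: "frac ((F ^^ k) (R x) - \<theta>0) = (G \<tau> ^^ k) (rho \<tau> y)" for k
    by (simp add: frac_funpow_F frac_R \<tau>_def y_def)
  have Gm: "frac ((F ^^ k) ((F ^^ m) x) - \<theta>0) = (G \<tau> ^^ k) ((G \<tau> ^^ m) y)" for k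
    by (simp add: frac_funpow_F \<tau>_def y_def)
  have ind: "fst (cell ((F ^^ k) (R x))) = fst (cell ((F ^^ k) ((F ^^ m) x)))" for k
    using m unfolding parallel_def by (simp add: cell_def Ry Gm)
  define n' where "n' = \<lfloor>R x - \<theta>0\<rfloor> - \<lfloor>(F ^^ m) x - \<theta>0\<rfloor>"
  \<comment> \<open>Along the two orbits the difference of the points and the difference of their
    fractional parts are both constant, hence so is the difference of the integer parts.\<close>
  have "snd (cell ((F ^^ k) (R x))) = snd (cell ((F ^^ k) ((F ^^ m) x))) + n'" for k
  proof -
    have 1: "(F ^^ k) (R x) - (F ^^ k) ((F ^^ m) x) = R x - (F ^^ m) x"
      by (rule funpow_same_index) (rule ind)
    have 2: "frac ((F ^^ k) (R x) - \<theta>0) - frac ((F ^^ k) ((F ^^ m) x) - \<theta>0)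
        = frac (R x - \<theta>0) - frac ((F ^^ m) x - \<theta>0)"
      using m Ry[of 0] Gm[of 0] by (simp add: parallel_def Ry Gm)
    have "real_of_int (\<lfloor>(F ^^ k) (R x) - \<theta>0\<rfloor>) = of_int (\<lfloor>(F ^^ k) ((F ^^ m) x) - \<theta>0\<rfloor> + n')"
      using 1 2 unfolding n'_def frac_def by simp
    then show ?thesis by (simp only: cell_def snd_conv of_int_eq_iff)
  qed
  then have folR: "follow (R x) ((F ^^ m) x + of_int n')"
    unfolding follow_def funpow_F_add_int cell_add_int using ind by (simp add: prod_eq_iff)
  have folRz: "follow (R z) (R x)" if z: "a < z" "z < b" for z
    unfolding follow_def
  proof
    fix k
    \<comment> \<open>With \<open>k + Suc j\<close> a multiple of the period, time reversal
      expresses \<open>k\<close> steps from \<open>R w\<close> through \<open>j\<close> steps from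
      \<open>w\<close>, where the itinerary is known.\<close>
    define j where "j = Suc k * q - k - 1"
    have "Suc k \<le> Suc k * q" using q(1) mult_le_mono2[of 1 q "Suc k"] by simp
    then have j: "k + Suc j = Suc k * q" unfolding j_def by linarith
    have *: "cell ((F ^^ k) (R w)) =
        (fst (cell ((F ^^ j) w)), - snd (cell ((F ^^ j) w)) - 1 + int (Suc k) * n)"
      if w: "a < w" "w < b" for w
    proof -
      have "(F ^^ q) w = w + of_int n"
        using follow_diff[OF fol[OF w], of q] q(2) by simp
      then have per: "(F ^^ (Suc k * q)) w = w + of_int (int (Suc k) * n)"
        by (rule funpow_period)
      have "R w = R ((F ^^ (Suc k * q)) w) + of_int (int (Suc k) * n)"
        unfolding per R_add_int by simp
      also have "(F ^^ (Suc k * q)) w = (F ^^ k) ((F ^^ Suc j) w)"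
        unfolding j[symmetric] funpow_add by simp
      finally have "(F ^^ k) (R w) = (F ^^ k) (R ((F ^^ k) ((F ^^ Suc j) w))) + of_int (int (Suc k) * n)"
        by (simp only: funpow_F_add_int)
      also have "(F ^^ k) (R ((F ^^ k) ((F ^^ Suc j) w))) = R ((F ^^ Suc j) w)"
        by (rule funpow_F_R_funpow_F) (use reg[OF w] in \<open>simp only: funpow_funpow\<close>)
      finally have "cell ((F ^^ k) (R w)) = (fst (cell (R ((F ^^ Suc j) w))), snd (cell (R ((F ^^ Suc j) w))) + int (Suc k) * n)"
        by (simp only: cell_add_int)
      also have "cell (R ((F ^^ Suc j) w)) = (fst (cell ((F ^^ j) w)), - snd (cell ((F ^^ j) w)) - 1)"
        using F_R_F(2)[OF reg[OF w, of j]] by simp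
      finally show ?thesis by simp
    qed
    show "cell ((F ^^ k) (R z)) = cell ((F ^^ k) (R x))"
      unfolding *[OF z] *[OF ab] using fol[OF z] by (simp add: follow_def)
  qed
  \<comment> \<open>The map \<open>z\<close> to \<open>s - z\<close> is R followed by the inverse of
    the translation by which \<open>F ^^ m\<close> and the integer \<open>n'\<close> displace
    \<open>x\<close>.\<close>
  define s where "s = \<theta>0 + \<theta>1 - of_int n' - ((F ^^ m) x - x)"
  have "follow (s - z) x" if z: "a < z" "z < b" for z
  proof -
    define w where "w = R z - of_int n'"
    have "follow (w + of_int n') ((F ^^ m) x + of_int n')"
      using follow_trans[OF folRz[OF z] folR] by (simp add: w_def)
    then have w: "follow w ((F ^^ m) x)" by (simp only: follow_add_int)
    have le: "m \<le> m * q" using q(1) by simp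
    \<comment> \<open>By periodicity \<open>F ^^ ?j\<close> undoes \<open>F ^^ m\<close> up to an
      integer.\<close>
    let ?j = "m * q - m"
    have xx: "(F ^^ ?j) ((F ^^ m) x) = x + of_int (int m * n)"
      using funpow_period[OF q(2), of m] le by (simp add: funpow_funpow)
    have "(F ^^ ?j) w - (F ^^ ?j) ((F ^^ m) x) = w - (F ^^ m) x" by (rule follow_diff[OF w])
    then have "(F ^^ ?j) w = (s - z) + of_int (int m * n)"
      unfolding xx by (simp add: w_def s_def cem_refl_def)
    then have "follow ((s - z) + of_int (int m * n)) (x + of_int (int m * n))"
      using follow_funpow[OF w, of ?j] unfolding xx by simp
    then show ?thesis by (simp only: follow_add_int)
  qed
  then have "s = a + b" using reflected_interval[of a b s] ab sub by (meson less_trans)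
  then have "\<theta>0 + \<theta>1 - b = a + ((F ^^ m) x - x) + of_int n'" by (simp add: s_def)
  then show ?thesis by blast
qed

end

section \<open>Interiors\<close>

lemma bounded_interval_Inf_Sup:
  fixes C :: "real set"
  assumes "is_interval C" "C \<noteq> {}" "bdd_below C" "bdd_above C"
  shows "{Inf C<..<Sup C} \<subseteq> C" "C \<subseteq> {Inf C..Sup C}"
proof -
  show "{Inf C<..<Sup C} \<subseteq> C"
  proof
    fix z assume z: "z \<in> {Inf C<..<Sup C}"
    obtain u where "u \<in> C" "u < z" using z assms cInf_less_iff[of C z] by auto
    moreover obtain v where "v \<in> C" "z < v" using z assms less_cSup_iff[of C z] by auto
    ultimately show "z \<in> C" using assms(1) unfolding is_interval_1 by (meson less_imp_le)
  qed
  show "C \<subseteq> {Inf C..Sup C}" using assms by (auto intro: cInf_lower cSup_upper)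
qed

text \<open>The stray point \<open>c\<close> allows for \<open>iem_refl\<close>, which fixes 0
  instead of sending it to 1.\<close>

lemma interior_almost_interval:
  fixes a b c :: real
  assumes "{a<..<b} \<subseteq> X" "X \<subseteq> insert c {a..b}"
  shows "interior X = {a<..<b}"
proof
  have "interior X \<subseteq> interior ({a..b} \<union> {c})" using assms(2) by (intro interior_mono) auto
  also have "\<dots> = {a<..<b}"
    by (subst interior_closed_Un_empty_interior) (simp_all add: interior_atLeastAtMost_real)
  finally show "interior X \<subseteq> {a<..<b}" .
  show "{a<..<b} \<subseteq> interior X" using assms(1) by (intro interior_maximal) auto
qed

text \<open>Up to end points \<open>X\<close> is the union of the integer translates of one
  interval. Length below 1 keeps the closed translates apart, so no end point can become
  interior.\<close>

lemma interior_periodic_arc: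
  fixes a b :: real
  assumes "b - a < 1"
    and inner: "\<And>z n. a < z - of_int n \<Longrightarrow> z - of_int n < b \<Longrightarrow> z \<in> X"
    and outer: "\<And>z. z \<in> X \<Longrightarrow> \<exists>n::int. a \<le> z - of_int n \<and> z - of_int n \<le> b"
  shows "interior X = {z. \<exists>n::int. a < z - of_int n \<and> z - of_int n < b}" (is "_ = ?Y")
proof
  have "?Y = (\<Union>n::int. {a + of_int n<..<b + of_int n})" by (auto simp: algebra_simps)
  then have "open ?Y" by auto
  then show "?Y \<subseteq> interior X" using inner by (intro interior_maximal) auto
  show "interior X \<subseteq> ?Y"
  proof
    fix z assume z: "z \<in> interior X"
    then obtain e where e: "0 < e" "\<And>w. \<bar>w - z\<bar> < e \<Longrightarrow> w \<in> X"
      unfolding mem_interior by (auto simp: subset_iff dist_real_def abs_minus_commute)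
    \<comment> \<open>So small that \<open>z - \<delta>\<close>, \<open>z\<close> and
      \<open>z + \<delta>\<close> must lie in the same closed translate, which puts \<open>z\<close>
      strictly inside.\<close>
    define \<delta> where "\<delta> = min (e / 2) ((1 - (b - a)) / 2)"
    have \<delta>: "0 < \<delta>" "\<delta> < e" "\<delta> < 1 - (b - a)" using e(1) assms(1) unfolding \<delta>_def min_def by auto
    obtain n :: int where n: "a \<le> z - of_int n" "z - of_int n \<le> b"
      using outer[of z] e by auto
    obtain k :: int where k: "a \<le> z - \<delta> - of_int k" "z - \<delta> - of_int k \<le> b"
      using outer[of "z - \<delta>"] e(2)[of "z - \<delta>"] \<delta> by auto
    obtain l :: int where l: "a \<le> z + \<delta> - of_int l" "z + \<delta> - of_int l \<le> b"
      using outer[of "z + \<delta>"] e(2)[of "z + \<delta>"] \<delta> by auto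
    have "of_int (n - k) < (1::real)" "of_int (n - k) > (-1::real)"
      "of_int (n - l) < (1::real)" "of_int (n - l) > (-1::real)" using n k l \<delta> by auto
    then have "k = n" "l = n" by linarith+
    then show "z \<in> ?Y" using k l \<delta>(1) by (auto intro!: exI[of _ n])
  qed
qed

section \<open>Periodic intervals and arcs\<close>

context sym_lengths
begin

lemma iem_in_unit:
  assumes "0 \<le> y" "y < 1"
  shows "0 \<le> sym_iem lam d y" "sym_iem lam d y < 1" "sym_iem lam d y = sym_cem lam d 0 0 y"
proof -
  have "frac y = y" using assms by (simp add: frac_eq)
  then show "sym_iem lam d y = sym_cem lam d 0 0 y" by (simp add: sym_iem_def sym_cem_def)
  have i: "idx y < d" "pt (idx y) \<le> y" "y < pt (Suc (idx y))" using idx_props assms by auto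
  have "sym_iem lam d y = y + 1 - pt (idx y) - pt (Suc (idx y))"
    using sym_omega_eq[OF i(1)] by (simp add: sym_iem_def)
  then show "0 \<le> sym_iem lam d y" "sym_iem lam d y < 1" using i pt_bounds[OF i(1)] by auto
qed

lemma funpow_iem:
  assumes "0 \<le> y" "y < 1"
  shows "0 \<le> (sym_iem lam d ^^ k) y \<and> (sym_iem lam d ^^ k) y < 1 \<and>
    (sym_iem lam d ^^ k) y = (sym_cem lam d 0 0 ^^ k) y"
proof (induction k)
  case (Suc k)
  then show ?case using iem_in_unit[of "(sym_iem lam d ^^ k) y"] by simp
qed (use assms in simp)

lemma iem_symmetric:
  assumes J: "iem_periodic_interval lam d J q"
  shows "\<exists>k. interior (iem_refl ` J) = interior ((sym_iem lam d ^^ k) ` J)"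
proof (cases "J = {}")
  case False
  then obtain x0 where x0: "x0 \<in> J" by blast
  interpret sym_rotation lam d 0 0 by unfold_locales
  let ?T = "sym_iem lam d"
  have q: "0 < q" "(?T ^^ q) ` J = J" and elem: "\<And>k. \<exists>i<d. (?T ^^ k) ` J \<subseteq> elem_int lam i"
    and maxi: "\<And>J'. is_interval J' \<Longrightarrow> J \<subseteq> J' \<Longrightarrow> (?T ^^ q) ` J' = J' \<Longrightarrow>
      (\<And>k. \<exists>i<d. (?T ^^ k) ` J' \<subseteq> elem_int lam i) \<Longrightarrow> J' = J"
    using J unfolding iem_periodic_interval_def by blast+
  have cell_elem: "cell y = (i, 0) \<longleftrightarrow> y \<in> elem_int lam i" if "i < d" for y i
    using cell_eqI[OF that, of 0 y] cell_bounds[of y i 0] by (auto simp: elem_int_def)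
  have Junit: "0 \<le> y" "y < 1" if yJ: "y \<in> J" for y
  proof -
    obtain i where i: "i < d" "y \<in> elem_int lam i" using elem[of 0] yJ by auto
    then show "0 \<le> y" "y < 1" using pt_bounds[OF i(1)] by (auto simp: elem_int_def)
  qed
  have TF: "(?T ^^ k) y = (F ^^ k) y" if "0 \<le> y" "y < 1" for k y using funpow_iem that by blast
  have cells: "\<exists>i<d. \<forall>y\<in>J. cell ((F ^^ k) y) = (i, 0)" for k
  proof -
    obtain i where i: "i < d" "(?T ^^ k) ` J \<subseteq> elem_int lam i" using elem by blast
    have "cell ((F ^^ k) y) = (i, 0)" if "y \<in> J" for y
      using cell_elem[OF i(1)] i(2) TF[of y k] Junit[OF that] that by (auto simp: image_subset_iff)
    then show ?thesis using i by blast
  qed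
  have fol: "follow u v" if "u \<in> J" "v \<in> J" for u v
    unfolding follow_def using cells that by metis
  define s where "s = (F ^^ q) x0 - x0"
  have "y + s \<in> J" if "y \<in> J" for y
  proof -
    have "(?T ^^ q) y \<in> J" using q(2) that by blast
    moreover have "(F ^^ q) y = y + s" using follow_diff[OF fol[OF that x0], of q] by (simp add: s_def)
    ultimately show ?thesis using TF[of y q] Junit[OF that] by simp
  qed
  moreover have "J \<subseteq> {0..1}" using Junit by (auto simp: less_eq_real_def)
  ultimately have "s = 0" using bounded_translation_zero[OF x0] by blast
  define C where "C = {z. follow z x0}"
  have perC: "(F ^^ q) z = z" if "z \<in> C" for z
    using follow_diff[of z x0 q] that \<open>s = 0\<close> by (simp add: C_def s_def)
  have cell0: "\<exists>i<d. cell ((F ^^ k) x0) = (i, 0)" for k using cells[of k] x0 by blast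
  have Cunit: "0 \<le> z" "z < 1" if "z \<in> C" for z
  proof -
    obtain i where i: "i < d" "cell x0 = (i, 0)" using cell0[of 0] by auto
    show "0 \<le> z" "z < 1" using follow_bounds[of z x0] that i pt_bounds[OF i(1)] by (auto simp: C_def)
  qed
  \<comment> \<open>The whole itinerary class competes in the maximality condition, so it is no
    larger than \<open>J\<close>.\<close>
  have "C = J"
  proof (rule maxi)
    show "is_interval C" unfolding C_def by (rule is_interval_follow)
    show "J \<subseteq> C" using fol x0 by (auto simp: C_def)
    show "(?T ^^ q) ` C = C" using perC Cunit TF by (simp add: image_def)
    show "\<exists>i<d. (?T ^^ k) ` C \<subseteq> elem_int lam i" for k
    proof -
      obtain i where i: "i < d" "cell ((F ^^ k) x0) = (i, 0)" using cell0 by blast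
      have "(?T ^^ k) z \<in> elem_int lam i" if "z \<in> C" for z
      proof -
        have "cell ((F ^^ k) z) = (i, 0)" using that i by (simp add: C_def follow_def)
        then show ?thesis using cell_elem[OF i(1)] TF Cunit that by simp
      qed
      then show ?thesis using i by blast
    qed
  qed
  define a b where "a = Inf C" and "b = Sup C"
  have ne: "C \<noteq> {}" using \<open>C = J\<close> x0 by blast
  have bdd: "bdd_below C" "bdd_above C" using Cunit unfolding bdd_below_def bdd_above_def by (meson less_imp_le)+
  have "is_interval C" unfolding C_def by (rule is_interval_follow)
  note ab = bounded_interval_Inf_Sup[OF this ne bdd, folded a_def b_def]
  have a0: "0 \<le> a" unfolding a_def using ne Cunit by (intro cInf_greatest) auto
  have b1: "b \<le> 1" unfolding b_def using ne Cunit by (intro cSup_least) (auto intro: less_imp_le)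
  have intR: "interior (iem_refl ` C) = {1 - b<..<1 - a}"
  proof (rule interior_almost_interval[where c = 0])
    have refl_eq: "iem_refl z = 1 - z" if "0 < z" "z < 1" for z
      unfolding iem_refl_def frac_unique_iff using that by simp
    show "{1 - b<..<1 - a} \<subseteq> iem_refl ` C"
    proof
      fix w assume w: "w \<in> {1 - b<..<1 - a}"
      then have "1 - w \<in> C" using ab(1) by (auto simp: subset_iff)
      moreover have "iem_refl (1 - w) = w" using refl_eq[of "1 - w"] w a0 b1 by auto
      ultimately show "w \<in> iem_refl ` C" by (metis imageI)
    qed
    show "iem_refl ` C \<subseteq> insert 0 {1 - b..1 - a}"
    proof clarify
      fix z assume z: "z \<in> C" "iem_refl z \<notin> {1 - b..1 - a}"
      have "a \<le> z" "z \<le> b" using ab(2) z(1) by auto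
      then have "z = 0" using refl_eq[of z] z Cunit[OF z(1)] by force
      then show "iem_refl z = 0" by (simp add: iem_refl_def)
    qed
  qed
  show ?thesis
  \<comment> \<open>If \<open>J\<close> is a single point, both interiors are empty.\<close>
  proof (cases "a < b")
    case False
    then have "interior C = {}" using interior_almost_interval[of a b C a] ab by auto
    moreover have "interior (iem_refl ` C) = {}" using intR False by simp
    ultimately show ?thesis unfolding \<open>C = J\<close> by (intro exI[of _ 0]) simp
  next
    case True
    define x where "x = (a + b) / 2"
    have x: "a < x" "x < b" using True by (auto simp: x_def)
    then have xC: "x \<in> C" using ab(1) by auto
    then have Cx: "follow z x \<longleftrightarrow> z \<in> C" for z
      using follow_sym follow_trans unfolding C_def by blast
    obtain m n' where m: "- b = a + ((F ^^ m) x - x) + of_int n'"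
      using reflected_class[of a x b q 0] x q(1) perC[OF xC] ab unfolding Cx
      by (force simp: subset_iff)
    define t where "t = (F ^^ m) x - x"
    have "(?T ^^ m) x = x + t" using TF Cunit[OF xC] by (simp add: t_def)
    then have "0 \<le> x + t" "x + t < 1" using funpow_iem[of x m] Cunit[OF xC] by auto
    moreover have "x + t = - x - of_int n'" using m unfolding t_def[symmetric] by (simp add: x_def field_simps)
    \<comment> \<open>The midpoint \<open>x\<close> and its image \<open>x + t\<close> both lie in
      the unit interval and their sum is the integer \<open>- n'\<close>, which must be 1.\<close>
    ultimately have "- of_int n' < (2::real)" "0 < - (of_int n' :: real)" using x a0 b1 by linarith+
    then have "n' = -1" by linarith
    then have t: "1 - b = a + t" "1 - a = b + t" using m by (auto simp: t_def)
    have Tm: "(?T ^^ m) z = z + t" if "z \<in> C" for z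
      using follow_diff[of z x m] TF[of z m] Cunit[OF that] Cx that by (simp add: t_def)
    have "interior ((?T ^^ m) ` C) = {1 - b<..<1 - a}"
    proof (rule interior_almost_interval[where c = "1 - b"])
      show "{1 - b<..<1 - a} \<subseteq> (?T ^^ m) ` C"
      proof
        fix w assume "w \<in> {1 - b<..<1 - a}"
        then have "w - t \<in> C" using ab(1) t by auto
        then show "w \<in> (?T ^^ m) ` C" using Tm by (metis diff_add_cancel imageI)
      qed
      show "(?T ^^ m) ` C \<subseteq> insert (1 - b) {1 - b..1 - a}"
        using ab(2) t Tm by (auto simp: subset_iff)
    qed
    then show ?thesis using intR unfolding \<open>C = J\<close> by blast
  qed
qed simp

end

section \<open>Periodic arcs of the circle map\<close>

context sym_rotation
begin

lemma mem_elem_arc: "i < d \<Longrightarrow> y \<in> elem_arc lam \<theta>0 i \<longleftrightarrow> fst (cell y) = i"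
  using idx_eqI[of i "frac (y - \<theta>0)"] idx_props[of "frac (y - \<theta>0)"]
  by (auto simp: elem_arc_def elem_int_def cell_def frac_lt_1)

text \<open>To pass from one lift of a piece to another, a segment must cross the start of the
  following piece. With a single piece this fails, because its lifts adjoin each other.\<close>

lemma cell_const_on_segment:
  assumes "2 \<le> d" "u \<le> v" and const: "\<And>w. u \<le> w \<Longrightarrow> w \<le> v \<Longrightarrow> fst (cell w) = i"
  shows "cell u = cell v"
proof -
  obtain n where u: "cell u = (i, n)" using const[of u] assms(2) by (metis order_refl prod.collapse)
  obtain n' where v: "cell v = (i, n')" using const[of v] assms(2) by (metis order_refl prod.collapse)
  have "n \<le> n'" using u v assms(2) by (auto simp: cell_def intro: floor_mono)
  moreover have False if "n < n'"
  proof -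
    have i: "i < d" using cell_bounds(1)[OF u] .
    have "of_int n + 1 \<le> (of_int n' :: real)" using that by linarith
    then have v': "\<theta>0 + of_int n + 1 \<le> v" using cell_bounds(2)[OF v] pt_bounds[OF i] by linarith
    have u': "u < \<theta>0 + of_int n + pt (Suc i)" using cell_bounds(3)[OF u] .
    show False
    \<comment> \<open>The witness is the start of the next piece; after the last piece it is the
      first piece of the next turn.\<close>
    proof (cases "Suc i < d")
      case True
      have "cell (\<theta>0 + of_int n + pt (Suc i)) = (Suc i, n)"
        using pt_less_Suc[OF True] True by (intro cell_eqI) auto
      then show False using const[of "\<theta>0 + of_int n + pt (Suc i)"] u' v' pt_bounds(2)[OF i] by auto
    next
      case False
      have "cell (\<theta>0 + of_int n + 1) = (0, n + 1)"
        using pt_less_Suc[of 0] assms(1) by (intro cell_eqI) auto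
      then show False using const[of "\<theta>0 + of_int n + 1"] u' v' pt_bounds(2)[OF i] False assms(1) by auto
    qed
  qed
  ultimately show ?thesis using u v by fastforce
qed

lemma lam_less_1:
  assumes "2 \<le> d" "i < d"
  shows "pt (Suc i) - pt i < 1"
proof (cases "Suc i < d")
  case True
  then show ?thesis using pt_less_Suc[OF True] pt_bounds(2)[OF True] pt_bounds(1)[OF assms(2)] by linarith
next
  case False
  then have "1 \<le> i" using assms by simp
  then have "0 < pt i" using pt_mono[of 1 i] pt_less_Suc[of 0] assms by simp
  then show ?thesis using pt_bounds(2)[OF assms(2)] by linarith
qed

lemma cem_symmetric:
  assumes A: "cem_periodic_arc lam d \<theta>0 \<theta>1 A q"
  shows "\<exists>k. interior (R ` A) = interior ((F ^^ k) ` A)"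
proof -
  have q: "0 < q" "(F ^^ q) ` A = A" and elem: "\<And>k. \<exists>i<d. (F ^^ k) ` A \<subseteq> elem_arc lam \<theta>0 i"
    and maxi: "\<And>A'. circle_arc A' \<Longrightarrow> A \<subseteq> A' \<Longrightarrow> (F ^^ q) ` A' = A' \<Longrightarrow>
      (\<And>k. \<exists>i<d. (F ^^ k) ` A' \<subseteq> elem_arc lam \<theta>0 i) \<Longrightarrow> A' = A" and arc: "circle_arc A"
    using A unfolding cem_periodic_arc_def by blast+
  obtain I where I: "is_interval I" "A = {x. \<exists>n::int. x - of_int n \<in> I}"
    using arc unfolding circle_arc_def by blast
  have d: "0 < d" using lam_sum by (cases d) auto
  consider "A = {}" | "d = 1" | "A \<noteq> {}" "2 \<le> d" using d by linarith
  then show ?thesis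
  proof cases
    case 1
    then show ?thesis by simp
  next
    case 2
    \<comment> \<open>With one piece F is a rotation and the whole circle is admissible, so
      maximality makes \<open>A\<close> the whole circle.\<close>
    have arc0: "elem_arc lam \<theta>0 0 = UNIV" using mem_elem_arc[OF d] cell_less_d 2 by auto
    have F0: "F y = y + (\<theta>1 - \<theta>0)" for y
      using F_cell[of y] cell_less_d[of y] 2 by (simp add: sym_omega_def)
    have Fk: "(F ^^ k) y = y + real k * (\<theta>1 - \<theta>0)" for k y
    proof (induction k)
      case (Suc k)
      then show ?case using F0[of "(F ^^ k) y"] by (simp add: algebra_simps)
    qed simp
    have "UNIV = A"
    proof (rule maxi)
      show "circle_arc UNIV" unfolding circle_arc_def by (intro exI[of _ UNIV]) auto
      show "(F ^^ q) ` UNIV = UNIV" unfolding Fk by (rule surj_plus_right)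
      show "\<exists>i<d. (F ^^ k) ` UNIV \<subseteq> elem_arc lam \<theta>0 i" for k using arc0 d by auto
    qed simp
    moreover have "R ` UNIV = UNIV"
    proof -
      have "w = R (R w)" for w by (simp add: cem_refl_def)
      then show ?thesis by (metis surjI)
    qed
    ultimately show ?thesis by (intro exI[of _ 0]) simp
  next
    case 3
    have IA: "I \<subseteq> A" using I(2) by (auto intro!: exI[of _ 0])
    obtain x0 where x0: "x0 \<in> I" using 3 I(2) by auto
    have indA: "\<exists>i<d. \<forall>y\<in>A. fst (cell ((F ^^ k) y)) = i" for k
      using elem[of k] mem_elem_arc by (fastforce simp: image_subset_iff)
    have diffA: "(F ^^ k) u - (F ^^ k) v = u - v" if "u \<in> A" "v \<in> A" for u v k
      by (rule funpow_same_index) (use indA that in metis)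
    have cells: "cell ((F ^^ k) u) = cell ((F ^^ k) v)" if uv: "u \<in> I" "v \<in> I" "u \<le> v" for u v k
    proof -
      obtain i where i: "\<forall>y\<in>A. fst (cell ((F ^^ k) y)) = i" using indA by blast
      have uv': "(F ^^ k) u - (F ^^ k) v = u - v" using diffA IA uv by blast
      show ?thesis
      proof (rule cell_const_on_segment[OF 3(2), where i = i])
        show "(F ^^ k) u \<le> (F ^^ k) v" using uv uv' by linarith
        fix w assume w: "(F ^^ k) u \<le> w" "w \<le> (F ^^ k) v"
        \<comment> \<open>The point between \<open>u\<close> and \<open>v\<close> that
          \<open>F ^^ k\<close>, a translation on \<open>A\<close>, carries to
          \<open>w\<close>.\<close>
        define w' where "w' = u + (w - (F ^^ k) u)"
        have "u \<le> w'" "w' \<le> v" using w uv' by (auto simp: w'_def)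
        then have "w' \<in> I" using I(1) uv unfolding is_interval_1 by blast
        then have "w' \<in> A" "u \<in> A" using IA uv by auto
        then have "(F ^^ k) w' = w" using diffA[of w' u k] by (simp add: w'_def)
        then show "fst (cell w) = i" using i \<open>w' \<in> A\<close> by blast
      qed
    qed
    have fol: "follow u v" if "u \<in> I" "v \<in> I" for u v
      unfolding follow_def using cells that by (metis linear)
    define C where "C = {z. follow z x0}"
    have IC: "I \<subseteq> C" using fol x0 by (auto simp: C_def)
    obtain i0 n0 where c0: "cell x0 = (i0, n0)" by fastforce
    have i0: "i0 < d" using cell_bounds(1)[OF c0] .
    have Cb: "\<theta>0 + of_int n0 + pt i0 \<le> z" "z \<le> \<theta>0 + of_int n0 + pt (Suc i0)" if "z \<in> C" for z
      using follow_bounds[of z x0] that c0 by (auto simp: C_def)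
    \<comment> \<open>The return map brings \<open>I\<close> back only up to an integer. Comparing
      cells shows below that this integer is the same for all points of \<open>I\<close>, so that
      the bounded interval \<open>I\<close> is translated into itself.\<close>
    obtain n :: int where n: "(F ^^ q) x0 - of_int n \<in> I" using q(2) IA x0 I(2) by blast
    have "(F ^^ q) x0 - of_int n - x0 = 0"
    proof (rule bounded_translation_zero[OF x0])
      show "I \<subseteq> {\<theta>0 + of_int n0 + pt i0..\<theta>0 + of_int n0 + pt (Suc i0)}" using Cb IC by auto
      fix y assume y: "y \<in> I"
      obtain k :: int where k: "(F ^^ q) y - of_int k \<in> I" using q(2) IA y I(2) by blast
      have "snd (cell ((F ^^ q) y - of_int k)) = snd (cell ((F ^^ q) x0 - of_int n))"
        using fol[OF k n] unfolding follow_def by (metis funpow_0)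
      moreover have "snd (cell ((F ^^ q) y)) = snd (cell ((F ^^ q) x0))"
        using fol[OF y x0] unfolding follow_def by metis
      ultimately have "k = n"
        using cell_add_int[of "(F ^^ q) y" "- k"] cell_add_int[of "(F ^^ q) x0" "- n"] by simp
      moreover have "(F ^^ q) y - (F ^^ q) x0 = y - x0" using diffA y x0 IA by blast
      then have "y + ((F ^^ q) x0 - of_int n - x0) = (F ^^ q) y - of_int n" by linarith
      ultimately show "y + ((F ^^ q) x0 - of_int n - x0) \<in> I" using k by (simp only:)
    qed
    then have per: "(F ^^ q) x0 = x0 + of_int n" by simp
    have perC: "(F ^^ q) z = z + of_int n" if "z \<in> C" for z
      using follow_diff[of z x0 q] that per by (simp add: C_def)
    \<comment> \<open>The integer translates of the class form an admissible arc containing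
      \<open>A\<close>, so maximality applies.\<close>
    have "{x. \<exists>n::int. x - of_int n \<in> C} = A" (is "?A' = A")
    proof (rule maxi)
      show "circle_arc ?A'" unfolding circle_arc_def C_def using is_interval_follow by blast
      show "A \<subseteq> ?A'" using IC I(2) by blast
      have FA': "(F ^^ k) y = (F ^^ k) (y - of_int j) + of_int j" for y k j
        using funpow_F_add_int[of k "y - of_int j" j] by simp
      have "(F ^^ q) y = y + of_int n" if y: "y \<in> ?A'" for y
      proof -
        obtain j :: int where "y - of_int j \<in> C" using y by blast
        then show ?thesis using FA'[of q y j] perC by simp
      qed
      then have "(F ^^ q) ` ?A' = (\<lambda>y. y + of_int n) ` ?A'" by (rule image_cong[OF refl])
      also have "\<dots> = ?A'"
      proof
        show "(\<lambda>y. y + of_int n) ` ?A' \<subseteq> ?A'"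
        proof clarify
          fix y and j :: int assume "y - of_int j \<in> C"
          then show "\<exists>k::int. y + of_int n - of_int k \<in> C" by (intro exI[of _ "j + n"]) simp
        qed
        show "?A' \<subseteq> (\<lambda>y. y + of_int n) ` ?A'"
        proof clarify
          fix y and j :: int assume "y - of_int j \<in> C"
          then have "y - of_int n \<in> ?A'" by (auto intro!: exI[of _ "j - n"])
          then show "y \<in> (\<lambda>y. y + of_int n) ` ?A'" by (rule rev_image_eqI) simp
        qed
      qed
      finally show "(F ^^ q) ` ?A' = ?A'" .
      show "\<exists>i<d. (F ^^ k) ` ?A' \<subseteq> elem_arc lam \<theta>0 i" for k
      proof (intro exI conjI)
        show "fst (cell ((F ^^ k) x0)) < d" by (rule cell_less_d)
        show "(F ^^ k) ` ?A' \<subseteq> elem_arc lam \<theta>0 (fst (cell ((F ^^ k) x0)))"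
        proof (rule image_subsetI)
          fix y assume "y \<in> ?A'"
          then obtain j :: int where "y - of_int j \<in> C" by blast
          then have "cell ((F ^^ k) (y - of_int j)) = cell ((F ^^ k) x0)"
            by (simp add: C_def follow_def)
          then have "fst (cell ((F ^^ k) y)) = fst (cell ((F ^^ k) x0))"
            unfolding FA'[of k y j] cell_add_int by simp
          then show "(F ^^ k) y \<in> elem_arc lam \<theta>0 (fst (cell ((F ^^ k) x0)))"
            using mem_elem_arc[OF cell_less_d] by blast
        qed
      qed
    qed
    then have AC: "y \<in> A \<longleftrightarrow> (\<exists>n::int. y - of_int n \<in> C)" for y by blast
    define a b where "a = Inf C" and "b = Sup C"
    have ne: "C \<noteq> {}" using IC x0 by blast
    have bdd: "bdd_below C" "bdd_above C" using Cb unfolding bdd_below_def bdd_above_def by meson+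
    have "is_interval C" unfolding C_def by (rule is_interval_follow)
    note ab = bounded_interval_Inf_Sup[OF this ne bdd, folded a_def b_def]
    have "\<theta>0 + of_int n0 + pt i0 \<le> a" unfolding a_def using ne Cb by (intro cInf_greatest) auto
    moreover have "b \<le> \<theta>0 + of_int n0 + pt (Suc i0)" unfolding b_def using ne Cb by (intro cSup_least) auto
    ultimately have short: "b - a < 1" using lam_less_1[OF 3(2) i0] by linarith
    let ?arc = "\<lambda>l r. {z. \<exists>n::int. l < z - of_int n \<and> z - of_int n < r}"
    have Ain: "y \<in> A" if "a < y - of_int j" "y - of_int j < b" for y j
      using that ab(1) AC by (auto simp: subset_iff)
    have Aout: "\<exists>n::int. a \<le> y - of_int n \<and> y - of_int n \<le> b" if "y \<in> A" for y
      using that ab(2) AC by (auto simp: subset_iff)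
    define c where "c = \<theta>0 + \<theta>1"
    have RR: "R y = c - y" for y by (simp add: cem_refl_def c_def)
    have intR: "interior (R ` A) = ?arc (c - b) (c - a)"
    proof (rule interior_periodic_arc)
      show "(c - a) - (c - b) < 1" using short by simp
      fix z and n :: int assume "c - b < z - of_int n" "z - of_int n < c - a"
      then have "c - z \<in> A" by (intro Ain[of _ "- n"]) auto
      then show "z \<in> R ` A" by (rule rev_image_eqI) (simp add: RR)
    next
      fix z assume "z \<in> R ` A"
      then obtain y where y: "y \<in> A" "z = c - y" by (auto simp: RR)
      then obtain n :: int where "a \<le> y - of_int n" "y - of_int n \<le> b" using Aout by blast
      then show "\<exists>n::int. c - b \<le> z - of_int n \<and> z - of_int n \<le> c - a"
        using y by (intro exI[of _ "- n"]) auto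
    qed
    show ?thesis
    proof (cases "a < b")
      case False
      have "interior A = ?arc a b" by (rule interior_periodic_arc[OF short Ain Aout])
      then have "interior A = interior (R ` A)" unfolding intR using False by fastforce
      then show ?thesis by (intro exI[of _ 0]) simp
    next
      case True
      define x where "x = (a + b) / 2"
      have x: "a < x" "x < b" using True by (auto simp: x_def)
      then have xC: "x \<in> C" using ab(1) by auto
      then have Cx: "follow z x \<longleftrightarrow> z \<in> C" for z
        using follow_sym follow_trans unfolding C_def by blast
      obtain m n' where m: "\<theta>0 + \<theta>1 - b = a + ((F ^^ m) x - x) + of_int n'"
        using reflected_class[of a x b q n] x q(1) perC[OF xC] ab unfolding Cx
        by (force simp: subset_iff)
      define t where "t = (F ^^ m) x - x"
      \<comment> \<open>Reflection and \<open>F ^^ m\<close> produce the same interval up to the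
        integer \<open>n'\<close>, which is invisible on the circle.\<close>
      have t: "c - b = a + t + of_int n'" "c - a = b + t + of_int n'" using m by (auto simp: t_def c_def)
      have xA: "x \<in> A" using Ain[of x 0] x by simp
      have Fm: "(F ^^ m) y = y + t" if "y \<in> A" for y
        using diffA[OF that xA, of m] by (simp add: t_def)
      have "interior ((F ^^ m) ` A) = ?arc (c - b) (c - a)"
      proof (rule interior_periodic_arc)
        show "(c - a) - (c - b) < 1" using short by simp
        fix z and n :: int assume "c - b < z - of_int n" "z - of_int n < c - a"
        then have "z - t \<in> A" using t by (intro Ain[of _ "n + n'"]) auto
        then show "z \<in> (F ^^ m) ` A" by (rule rev_image_eqI) (simp add: Fm[OF \<open>z - t \<in> A\<close>])
      next
        fix z assume "z \<in> (F ^^ m) ` A"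
        then obtain y where y: "y \<in> A" "z = y + t" using Fm by auto
        then obtain n :: int where "a \<le> y - of_int n" "y - of_int n \<le> b" using Aout by blast
        then show "\<exists>n::int. c - b \<le> z - of_int n \<and> z - of_int n \<le> c - a"
          using y t by (intro exI[of _ "n - n'"]) auto
      qed
      then show ?thesis using intR by blast
    qed
  qed
qed

end

theorem mainTheorem5:
  fixes lam :: "nat \<Rightarrow> real" and d :: nat and \<theta>0 \<theta>1 :: real
  assumes "1 \<le> d"
    and "\<forall>i<d. 0 < lam i"
    and "(\<Sum>i<d. lam i) = 1"
  shows "(\<forall>J q. iem_periodic_interval lam d J q \<longrightarrow>
            (\<exists>k. interior (iem_refl ` J) = interior ((sym_iem lam d ^^ k) ` J)))
       \<and> (\<forall>A q. cem_periodic_arc lam d \<theta>0 \<theta>1 A q \<longrightarrow>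
            (\<exists>k. interior (cem_refl \<theta>0 \<theta>1 ` A) = interior ((sym_cem lam d \<theta>0 \<theta>1 ^^ k) ` A)))"
proof -
  interpret sym_rotation lam d \<theta>0 \<theta>1
    by unfold_locales (use assms in auto)
  show ?thesis using iem_symmetric cem_symmetric by blast
qed

end
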